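(* Let $\mathbb K$ be a field, let $\chi=\sum_{k=-\infty}^{\infty}\chi_kx^k\in\mathbb L$ and $\mathbf v=[\ldots,\chi_{-1},\chi_0,\chi_1,\ldots]^T$. Let $\omega$ be a nonzero element of $\mathbb K((x))\cup\mathbb K((\frac1x))$ and $\mathbf B_\omega$ the associated bi-infinite matrix. (a) If $\omega\in\mathbb K((x))$ has positive order and $\chi\in\mathbb K((x))$, then $\mathbf B_\omega\mathbf v$ is well defined. (b) If $\omega\in\mathbb K((\frac1x))$ has negative order and $\chi\in\mathbb K((x))$, then $\mathbf B_\omega\mathbf v$ is well defined. (c) If $\omega\in\mathbb K((x))$ has negative order and $\chi\in\mathbb K((\frac1x))$, then $\mathbf B_\omega\mathbf v$ is well defined. (d) If $\omega\in\mathbb K((\frac1x))$ has positive order and $\chi\in\mathbb K((\frac1x))$, then $\mathbf B_\omega\mathbf v$ is well defined. (e) If $\omega\in\mathbb K((x))\cup\mathbb K((\frac1x))$ and $\chi\in\mathbb K((x))\cap\mathbb K((\frac1x))$, then $\mathbf B_\omega\mathbf v$ is well defined. In any of these cases, the resulting vector $\mathbf w=[\ldots,w_{-1},w_0,w_1,\ldots]^T=\mathbf B_\omega\mathbf v$ corresponds to the Laurent series $\psi=\sum_{k=-\infty}^{\infty}w_kx^k=\chi\circ\omega$, where this composition of elements of $\mathbb L$ is also well defined.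
   Context: $\mathbb L$ is the set of formal Laurent series $\sum_{k=-\infty}^{\infty}\omega_kx^k$ with $\omega_k\in\mathbb K$. $\mathbb K((x))\subset\mathbb L$ consists of those series for which there is $n\in\mathbb Z$ with $\omega_k=0$ for all $k<n$; $\mathbb K((\frac1x))\subset\mathbb L$ consists of those for which there is $n\in\mathbb Z$ with $\omega_k=0$ for all $k>n$. The order of a nonzero $\omega\in\mathbb K((x))$ is the smallest $k$ with $\omega_k\neq0$; the order of a nonzero $\omega\in\mathbb K((\frac1x))$ is the largest $k$ with $\omega_k\neq0$. The nonzero elements of each of $\mathbb K((x))$, $\mathbb K((\frac1x))$ form a group under the usual product of series. For nonzero $\omega\in\mathbb K((x))\cup\mathbb K((\frac1x))$, $\mathbf B_\omega=[b_{ij}]_{i,j\in\mathbb Z}$ is the bi-infinite matrix ($i$ row, $j$ column) with $\omega^j=\sum_{i\in\mathbb Z}b_{ij}x^i$ for every $j\in\mathbb Z$. Powers are taken in the field $\mathbb K((x))$ or $\mathbb K((\frac1x))$ in which $\omega$ is considered; if $\omega$ lies in both, it is understood to be considered as an element of one fixed choice of them, and its order and powers are taken there. The composition $\chi\circ\omega$ is the series $\sum_{i\in\mathbb Z}\chi_i\omega^i$; it is well defined when the powers $\omega^i$ are defined and, for each $k$, only finitely many of the terms $\chi_i\omega^i$ contribute a nonzero coefficient of $x^k$. The product of a bi-infinite matrix $[m_{ij}]_{i,j\in\mathbb Z}$ and a bi-infinite column vector $[\ldots,v_{-1},v_0,v_1,\ldots]^T$ is the vector with entries $w_i=\sum_{j\in\mathbb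 Z}m_{ij}v_j$; it is well defined if and only if for every $i$ only finitely many products $m_{ij}v_j$ are nonzero. *)

theory Defs
  imports
    "HOL-Computational_Algebra.Formal_Laurent_Series"
    "HOL-Library.Groups_Big_Fun"
begin

(* A two-sided series \<Sum>k. f k * x^k is its coefficient function f, so a bi-infinite column vector
   and the series with these coefficients are the same object. *)
type_synonym 'a series = "int \<Rightarrow> 'a"
type_synonym 'a bimatrix = "int \<Rightarrow> int \<Rightarrow> 'a"  (* row, then column *)

(* K((x)) consists of expansions at zero, K((1/x)) of expansions at infinity. A series lying in
   both is always taken together with a choice of expansion point. *)
datatype expansion_point = At_zero | At_infinity

fun laurent_field :: "expansion_point \<Rightarrow> 'a::zero series set" where
  "laurent_field At_zero = {f. \<exists>n. \<forall>k<n. f k = 0}"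
| "laurent_field At_infinity = {f. \<exists>n. \<forall>k>n. f k = 0}"

(* Meaningful only for nonzero elements of the respective field. *)
fun series_order :: "expansion_point \<Rightarrow> 'a::zero series \<Rightarrow> int" where
  "series_order At_zero f = (LEAST k. f k \<noteq> 0)"
| "series_order At_infinity f = (GREATEST k. f k \<noteq> 0)"

(* The integer power f^j in the field of the given expansion point. An element of K((1/x)) is a
   Laurent series in y = 1/x, its coefficient at y^k being the one at x^(-k). *)
fun series_power :: "expansion_point \<Rightarrow> 'a::field series \<Rightarrow> int \<Rightarrow> 'a series" where
  "series_power At_zero f j = fls_nth (Abs_fls f powi j)"
| "series_power At_infinity f j = (\<lambda>k. fls_nth (Abs_fls (\<lambda>i. f (- i)) powi j) (- k))"

definition power_matrix :: "expansion_point \<Rightarrow> 'a::field series \<Rightarrow> 'a bimatrix" where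
  "power_matrix p \<omega> = (\<lambda>i j. series_power p \<omega> j i)"

definition mat_vec_defined :: "'a::semiring_0 bimatrix \<Rightarrow> 'a series \<Rightarrow> bool" where
  "mat_vec_defined m v \<longleftrightarrow> (\<forall>i. finite {j. m i j * v j \<noteq> 0})"

(* Sum_any g is the sum of g over its support if that is finite (and 0 otherwise). *)
definition mat_vec :: "'a::semiring_0 bimatrix \<Rightarrow> 'a series \<Rightarrow> 'a series" where
  "mat_vec m v = (\<lambda>i. Sum_any (\<lambda>j. m i j * v j))"

definition compose_defined :: "expansion_point \<Rightarrow> 'a::field series \<Rightarrow> 'a series \<Rightarrow> bool" where
  "compose_defined p \<chi> \<omega> \<longleftrightarrow> \<omega> \<in> laurent_field p \<and> \<omega> \<noteq> (\<lambda>_. 0) \<and>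
     (\<forall>k. finite {i. \<chi> i * series_power p \<omega> i k \<noteq> 0})"

definition compose_series :: "expansion_point \<Rightarrow> 'a::field series \<Rightarrow> 'a series \<Rightarrow> 'a series" where
  "compose_series p \<chi> \<omega> = (\<lambda>k. Sum_any (\<lambda>i. \<chi> i * series_power p \<omega> i k))"


(* The following lemmas confirm that series_power p f, for nonzero f in the field, is the
   homomorphism j \<mapsto> f^j into the group of nonzero elements under the usual (convolution) product. *)

definition series_mult :: "'a::semiring_0 series \<Rightarrow> 'a series \<Rightarrow> 'a series" where
  "series_mult f g = (\<lambda>n. Sum_any (\<lambda>i. f i * g (n - i)))"

lemma fls_nth_mult_conv: "fls_nth (f * g) = series_mult (fls_nth f) (fls_nth g)"
  for f g :: "'a::semiring_0 fls"
proof
  fix n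
  have "fls_nth (f * g) n =
      (\<Sum>i=fls_subdegree f..n - fls_subdegree g. fls_nth f i * fls_nth g (n - i))"
    by (rule fls_times_nth(2))
  also have "\<dots> = Sum_any (\<lambda>i. fls_nth f i * fls_nth g (n - i))"
  proof (rule Sum_any.expand_superset[symmetric])
    show "{i. fls_nth f i * fls_nth g (n - i) \<noteq> 0} \<subseteq> {fls_subdegree f..n - fls_subdegree g}"
    proof
      fix i assume "i \<in> {i. fls_nth f i * fls_nth g (n - i) \<noteq> 0}"
      hence "fls_nth f i \<noteq> 0" "fls_nth g (n - i) \<noteq> 0" by auto
      hence "fls_subdegree f \<le> i" "fls_subdegree g \<le> n - i"
        by (auto intro: fls_subdegree_leI)
      thus "i \<in> {fls_subdegree f..n - fls_subdegree g}" by simp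
    qed
  qed simp
  finally show "fls_nth (f * g) n = series_mult (fls_nth f) (fls_nth g) n"
    by (simp add: series_mult_def)
qed

lemma series_mult_reflect:
  "series_mult (\<lambda>k. f (- k)) (\<lambda>k. g (- k)) n = series_mult f g (- n)"
  unfolding series_mult_def Sum_any.expand_set
  by (rule sum.reindex_bij_witness[where i = uminus and j = uminus])
    (auto simp: minus_diff_commute[of n])

lemma fls_nth_Abs_fls_at_zero:
  "f \<in> laurent_field At_zero \<Longrightarrow> fls_nth (Abs_fls f) = f"
  by (auto simp: fun_eq_iff intro!: nth_Abs_fls_ex_lower_bound)

lemma reflect_at_infinity:
  assumes "f \<in> laurent_field At_infinity"
  shows "(\<lambda>i. f (- i)) \<in> laurent_field At_zero"
proof -
  from assms obtain n where "\<forall>k>n. f k = 0" by auto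
  hence "\<forall>k<(- n). f (- k) = 0" by auto
  thus ?thesis by auto
qed

lemma Abs_fls_nonzero:
  assumes "f \<in> laurent_field At_zero" "f \<noteq> (\<lambda>_. 0)"
  shows "Abs_fls f \<noteq> 0"
proof
  assume "Abs_fls f = 0"
  hence "fls_nth (Abs_fls f) = (\<lambda>_. 0)" by (simp add: fun_eq_iff)
  with assms show False by (simp add: fls_nth_Abs_fls_at_zero)
qed

lemma series_power_in_field: "series_power p f j \<in> laurent_field p"
proof (cases p)
  case At_zero
  thus ?thesis by (auto intro!: exI fls_eq0_below_subdegree)
next
  case At_infinity
  show ?thesis unfolding At_infinity
    by (simp, rule exI[of _ "- fls_subdegree (Abs_fls (\<lambda>i. f (- i)) powi j)"])
      (auto intro!: fls_eq0_below_subdegree)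
qed

lemma series_power_0: "series_power p f 0 = (\<lambda>k. if k = 0 then 1 else 0)"
  by (cases p) (auto simp: fun_eq_iff)

lemma series_power_1: "f \<in> laurent_field p \<Longrightarrow> series_power p f 1 = f"
  by (cases p) (simp_all add: fls_nth_Abs_fls_at_zero fls_nth_Abs_fls_at_zero[OF reflect_at_infinity]
      del: laurent_field.simps)

lemma series_power_add:
  assumes "f \<in> laurent_field p" "f \<noteq> (\<lambda>_. 0)"
  shows "series_power p f (i + j) = series_mult (series_power p f i) (series_power p f j)"
proof (cases p)
  case At_zero
  with assms show ?thesis
    by (simp add: Abs_fls_nonzero power_int_add fls_nth_mult_conv del: laurent_field.simps)
next
  case At_infinity
  have "(\<lambda>i. f (- i)) \<noteq> (\<lambda>_. 0)"
    using assms(2) by (metis minus_minus)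
  with assms At_infinity have "Abs_fls (\<lambda>i. f (- i)) \<noteq> 0"
    by (intro Abs_fls_nonzero reflect_at_infinity) auto
  with At_infinity show ?thesis
    by (simp add: fun_eq_iff power_int_add fls_nth_mult_conv series_mult_reflect)
qed

end

theory Submission
  imports Defs
begin

text \<open>If \<omega> has order d, then \<open>\<omega>\<^sup>j\<close> has order jd, so row i of the matrix is supported on those j
  with \<open>jd \<le> i\<close> (expansion at zero) or \<open>jd \<ge> i\<close> (expansion at infinity). For \<open>d \<noteq> 0\<close> this is a
  half-line, and in each of the cases (a) to (d) it is unbounded only on the side on which the
  support of \<chi> is bounded.\<close>

text \<open>Passage to \<open>fls_subdegree\<close>, which the \<open>j\<close>-th integer power
  multiplies by \<open>j\<close>, negative \<open>j\<close> included.\<close>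

lemma series_order_At_zero:
  assumes "f \<in> laurent_field At_zero" "f \<noteq> (\<lambda>_. 0)"
  shows "series_order At_zero f = fls_subdegree (Abs_fls f)"
proof -
  have nth: "fls_nth (Abs_fls f) = f"
    using assms(1) by (rule fls_nth_Abs_fls_at_zero)
  have "f (fls_subdegree (Abs_fls f)) \<noteq> 0"
    using nth_fls_subdegree_nonzero[OF Abs_fls_nonzero[OF assms]] unfolding nth .
  moreover have "fls_subdegree (Abs_fls f) \<le> k" if "f k \<noteq> 0" for k
    using that fls_subdegree_leI[of "Abs_fls f" k] unfolding nth by simp
  ultimately show ?thesis by (auto intro!: Least_equality)
qed

text \<open>The substitution of 1/x for x turns the largest exponent into the negative of the
  smallest one, hence the minus sign.\<close>

lemma series_order_At_infinity:
  assumes "f \<in> laurent_field At_infinity" "f \<noteq> (\<lambda>_. 0)"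
  shows "series_order At_infinity f = - fls_subdegree (Abs_fls (\<lambda>i. f (- i)))"
proof -
  let ?g = "\<lambda>i. f (- i)"
  have nz: "?g \<noteq> (\<lambda>_. 0)"
    using assms(2) by (metis minus_minus)
  have g: "?g \<in> laurent_field At_zero"
    using assms(1) by (rule reflect_at_infinity)
  have nth: "fls_nth (Abs_fls ?g) = ?g"
    using g by (rule fls_nth_Abs_fls_at_zero)
  have "?g (fls_subdegree (Abs_fls ?g)) \<noteq> 0"
    using nth_fls_subdegree_nonzero[OF Abs_fls_nonzero[OF g nz]] unfolding nth .
  moreover have "k \<le> - fls_subdegree (Abs_fls ?g)" if "f k \<noteq> 0" for k
    using that fls_subdegree_leI[of "Abs_fls ?g" "- k"] unfolding nth by simp
  ultimately show ?thesis by (auto intro!: Greatest_equality)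
qed

text \<open>The order is a valuation on the field, so \<open>j * series_order At_zero f\<close> is
  the least exponent that occurs in the \<open>j\<close>-th power.\<close>

lemma series_power_At_zero_nonzeroD:
  assumes "f \<in> laurent_field At_zero" "f \<noteq> (\<lambda>_. 0)" "series_power At_zero f j k \<noteq> 0"
  shows "j * series_order At_zero f \<le> k"
  using fls_subdegree_leI[of "Abs_fls f powi j" k] assms(3)
  by (simp add: series_order_At_zero[OF assms(1,2)] fls_subdegree_power_int
      del: series_order.simps)

lemma series_power_At_infinity_nonzeroD:
  assumes "f \<in> laurent_field At_infinity" "f \<noteq> (\<lambda>_. 0)" "series_power At_infinity f j k \<noteq> 0"
  shows "k \<le> j * series_order At_infinity f"
  using fls_subdegree_leI[of "Abs_fls (\<lambda>i. f (- i)) powi j" "- k"] assms(3)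
  by (simp add: series_order_At_infinity[OF assms(1,2)] fls_subdegree_power_int
      del: series_order.simps)

lemma finite_half_line_multiples:
  fixes c d n :: int
  assumes "d > 0"
  shows "finite {j. n \<le> j \<and> j * d \<le> c}"
proof (rule finite_subset)
  \<comment> \<open>As \<open>d\<close> is positive and \<open>div\<close> rounds down, the bound
    \<open>c div d\<close> is correct for negative \<open>c\<close> too.\<close>
  show "{j. n \<le> j \<and> j * d \<le> c} \<subseteq> {n..c div d}"
  proof
    fix j assume j: "j \<in> {j. n \<le> j \<and> j * d \<le> c}"
    hence "(j * d) div d \<le> c div d" using assms by (intro zdiv_mono1) auto
    with j assms show "j \<in> {n..c div d}" by simp
  qed
qed simp

text \<open>Serves (a) and (b) together: the row bound \<open>c\<close> is left arbitrary so that an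
  inequality with negative slope can be negated first.\<close>

lemma mat_vec_defined_lower:
  assumes "v \<in> laurent_field At_zero" "d > 0"
    and "\<And>i j. m i j \<noteq> 0 \<Longrightarrow> j * d \<le> c i"
  shows "mat_vec_defined m v"
  unfolding mat_vec_defined_def
proof
  fix i
  obtain n where "\<And>k. k < n \<Longrightarrow> v k = 0" using assms(1) by auto
  hence "{j. m i j * v j \<noteq> 0} \<subseteq> {j. n \<le> j \<and> j * d \<le> c i}"
    using assms(3) by (force simp: not_less[symmetric])
  thus "finite {j. m i j * v j \<noteq> 0}"
    using finite_half_line_multiples[OF assms(2)] by (rule finite_subset)
qed

lemma mat_vec_defined_upper:
  assumes "v \<in> laurent_field At_infinity" "d > 0"
    and "\<And>i j. m i j \<noteq> 0 \<Longrightarrow> c i \<le> j * d"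
  shows "mat_vec_defined m v"
  unfolding mat_vec_defined_def
proof
  fix i
  obtain n where n: "\<And>k. k > n \<Longrightarrow> v k = 0" using assms(1) by auto
  \<comment> \<open>Replacing \<open>j\<close> by \<open>- j\<close> reverses both bounds but keeps
    the slope \<open>d\<close> positive.\<close>
  have "{j. m i j * v j \<noteq> 0} \<subseteq> uminus ` {j. - n \<le> j \<and> j * d \<le> - c i}"
  proof
    fix j assume "j \<in> {j. m i j * v j \<noteq> 0}"
    hence "m i j \<noteq> 0" "v j \<noteq> 0" by auto
    hence "c i \<le> j * d" "j \<le> n"
      using assms(3) n[of j] by (auto simp: not_less[symmetric])
    thus "j \<in> uminus ` {j. - n \<le> j \<and> j * d \<le> - c i}"
      by (intro image_eqI[of _ _ "- j"]) auto
  qed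
  thus "finite {j. m i j * v j \<noteq> 0}"
    using finite_imageI[OF finite_half_line_multiples[OF assms(2)]] by (rule finite_subset)
qed

text \<open>Here \<open>v\<close> is a Laurent polynomial, so finiteness comes from \<open>v\<close>
  alone; this is how (e) admits \<omega> of order 0.\<close>

lemma mat_vec_defined_finite_support:
  assumes "v \<in> laurent_field At_zero \<inter> laurent_field At_infinity"
  shows "mat_vec_defined m v"
  unfolding mat_vec_defined_def
proof
  fix i
  obtain a b where "\<And>k. k < a \<Longrightarrow> v k = 0" "\<And>k. k > b \<Longrightarrow> v k = 0"
    using assms by auto
  hence "{j. m i j * v j \<noteq> 0} \<subseteq> {a..b}" by (force simp: not_less[symmetric])
  thus "finite {j. m i j * v j \<noteq> 0}" by (rule finite_subset) simp
qed

text \<open>Row \<open>k\<close> of the product collects exactly the contributions to the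
  coefficient of x^k in the composition, with the factors commuted.\<close>

lemma compose_defined_iff_mat_vec_defined:
  assumes "f \<in> laurent_field p" "f \<noteq> (\<lambda>_. 0)"
  shows "compose_defined p g f \<longleftrightarrow> mat_vec_defined (power_matrix p f) g"
  using assms by (simp add: compose_defined_def mat_vec_defined_def power_matrix_def mult.commute)

text \<open>Both sides apply \<open>Sum_any\<close> to the same products, so they agree even where
  the support is infinite and the value defaults to 0.\<close>

lemma mat_vec_power_matrix: "mat_vec (power_matrix p f) g = compose_series p g f"
  by (simp add: mat_vec_def compose_series_def power_matrix_def mult.commute)

theorem theorem13:
  fixes \<chi> \<omega> :: "'a::field series" and p :: expansion_point
  assumes "\<omega> \<in> laurent_field p" and "\<omega> \<noteq> (\<lambda>_. 0)"
  shows "(p = At_zero \<and> series_order p \<omega> > 0 \<and> \<chi> \<in> laurent_field At_zero \<longrightarrow>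
       mat_vec_defined (power_matrix p \<omega>) \<chi>) \<and>
    (p = At_infinity \<and> series_order p \<omega> < 0 \<and> \<chi> \<in> laurent_field At_zero \<longrightarrow>
       mat_vec_defined (power_matrix p \<omega>) \<chi>) \<and>
    (p = At_zero \<and> series_order p \<omega> < 0 \<and> \<chi> \<in> laurent_field At_infinity \<longrightarrow>
       mat_vec_defined (power_matrix p \<omega>) \<chi>) \<and>
    (p = At_infinity \<and> series_order p \<omega> > 0 \<and> \<chi> \<in> laurent_field At_infinity \<longrightarrow>
       mat_vec_defined (power_matrix p \<omega>) \<chi>) \<and>
    (\<chi> \<in> laurent_field At_zero \<inter> laurent_field At_infinity \<longrightarrow>
       mat_vec_defined (power_matrix p \<omega>) \<chi>) \<and>
    ((p = At_zero \<and> series_order p \<omega> > 0 \<and> \<chi> \<in> laurent_field At_zero) \<or>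
     (p = At_infinity \<and> series_order p \<omega> < 0 \<and> \<chi> \<in> laurent_field At_zero) \<or>
     (p = At_zero \<and> series_order p \<omega> < 0 \<and> \<chi> \<in> laurent_field At_infinity) \<or>
     (p = At_infinity \<and> series_order p \<omega> > 0 \<and> \<chi> \<in> laurent_field At_infinity) \<or>
     (\<chi> \<in> laurent_field At_zero \<inter> laurent_field At_infinity) \<longrightarrow>
       compose_defined p \<chi> \<omega> \<and> mat_vec (power_matrix p \<omega>) \<chi> = compose_series p \<chi> \<omega>)"
proof -
  let ?d = "series_order p \<omega>" and ?B = "power_matrix p \<omega>"
  have zero: "j * ?d \<le> i" if "p = At_zero" "?B i j \<noteq> 0" for i j
    using series_power_At_zero_nonzeroD[of \<omega> j i] assms that
    by (simp add: power_matrix_def del: series_power.simps series_order.simps laurent_field.simps)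
  have infinity: "i \<le> j * ?d" if "p = At_infinity" "?B i j \<noteq> 0" for i j
    using series_power_At_infinity_nonzeroD[of \<omega> j i] assms that
    by (simp add: power_matrix_def del: series_power.simps series_order.simps laurent_field.simps)
  have a: "mat_vec_defined ?B \<chi>" if "p = At_zero" "?d > 0" "\<chi> \<in> laurent_field At_zero"
    using that zero by (intro mat_vec_defined_lower[where d = ?d and c = "\<lambda>i. i"])
  have b: "mat_vec_defined ?B \<chi>" if "p = At_infinity" "?d < 0" "\<chi> \<in> laurent_field At_zero"
    using that infinity
    \<comment> \<open>Negating \<open>i \<le> j * ?d\<close> gives
      \<open>j * (- ?d) \<le> - i\<close>, whose slope is positive.\<close>
    by (intro mat_vec_defined_lower[where d = "- ?d" and c = "\<lambda>i. - i"]) auto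
  have c: "mat_vec_defined ?B \<chi>" if "p = At_zero" "?d < 0" "\<chi> \<in> laurent_field At_infinity"
    using that zero
    by (intro mat_vec_defined_upper[where d = "- ?d" and c = "\<lambda>i. - i"]) auto
  have d: "mat_vec_defined ?B \<chi>" if "p = At_infinity" "?d > 0" "\<chi> \<in> laurent_field At_infinity"
    using that infinity by (intro mat_vec_defined_upper[where d = ?d and c = "\<lambda>i. i"])
  show ?thesis
    \<comment> \<open>After the rewriting, the claim on composition is again (a) to (e), together
      with a trivial equation.\<close>
    using a b c d mat_vec_defined_finite_support[of \<chi> ?B]
    unfolding compose_defined_iff_mat_vec_defined[OF assms] mat_vec_power_matrix by blast
qed

end
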